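(* Let $f: \mathbb{N} \to \mathbb{R}$ be any non-decreasing function. There is a strictly increasing sequence $(a_n)_{n \geq 1}$ of (non-negative) real numbers such that $a_n \geq f(n)$ for all $n\ge 1$ and the Rademacher random walk associated with $(a_n)_{n\ge 1}$ is topologically recurrent.
   Context: Let $\epsilon_1, \epsilon_2, \dots$ be independent Rademacher random variables, taking values $\pm 1$ each with probability $1/2$. The Rademacher random walk associated with a deterministic sequence $(a_n)_{n\ge1}$ of non-negative reals is $(X_n)_{n\ge 0}$, $X_n = \sum_{k=1}^n \epsilon_k a_k$. The walk is topologically recurrent if its range $\{X_n : n \ge 0\}$ is almost surely dense in $\mathbb{R}$. *)

theory Defs
  imports "HOL-Probability.Probability"
begin

text \<open>
  Sequences are indexed by the positive integers: the values \<open>\<epsilon> 0\<close> and \<open>a 0\<close>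
  are never used.
\<close>

definition (in prob_space) rademacher_sequence :: "(nat \<Rightarrow> 'a \<Rightarrow> real) \<Rightarrow> bool" where
  "rademacher_sequence \<epsilon> \<longleftrightarrow>
     indep_vars (\<lambda>_. borel) \<epsilon> {1..} \<and>
     (\<forall>n\<ge>1. prob {\<omega> \<in> space M. \<epsilon> n \<omega> = 1} = 1/2 \<and>
            prob {\<omega> \<in> space M. \<epsilon> n \<omega> = -1} = 1/2)"

definition rademacher_walk :: "(nat \<Rightarrow> 'a \<Rightarrow> real) \<Rightarrow> (nat \<Rightarrow> real) \<Rightarrow> nat \<Rightarrow> 'a \<Rightarrow> real" where
  "rademacher_walk \<epsilon> a n \<omega> = (\<Sum>k=1..n. \<epsilon> k \<omega> * a k)"

definition topologically_recurrent :: "'a measure \<Rightarrow> (nat \<Rightarrow> 'a \<Rightarrow> real) \<Rightarrow> bool" where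
  "topologically_recurrent M X \<longleftrightarrow> (AE \<omega> in M. closure (range (\<lambda>n. X n \<omega>)) = UNIV)"

end

theory Submission
  imports Defs
begin

text \<open>
  Huge steps are compatible with fine movements if consecutive steps are nearly equal. A block of
  \<open>m\<close> steps \<open>B + g 0 < B + g 1 < \<dots>\<close> with small \<open>g\<close> moves the walk by \<open>B S k + \<Sum>i<k. \<epsilon> i * g i\<close>, where \<open>S\<close> is
  the simple random walk with the same signs. Whenever \<open>S\<close> returns to \<open>0\<close>, the size of \<open>B\<close> is
  irrelevant and only the fine displacement remains.

  Up to a slight linear slope, let \<open>g\<close> be constant except for jumps \<open>e j\<close> at sparse times \<open>t j\<close>. By summation by parts, the fine
  displacement seen at returns after \<open>t j\<close> is \<open>- \<Sum>i\<le>j. e i * S (t i)\<close>. This is a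
  path whose jumps can be made small compared with \<open>\<delta>\<close>, while its variance becomes as large as desired. With
  probability at least \<open>1 / 24\<close> it crosses a given level at distance at most \<open>R\<close>, and then it comes
  \<open>\<delta>\<close>-close to that level. As \<open>S\<close> is recurrent, the gaps between the
  times \<open>t j\<close> can be chosen so long that very likely every displacement is realized at some return of \<open>S\<close>.
  This is \<open>hitting_block\<close>: a block whose length depends on \<open>R\<close> and \<open>\<delta>\<close> but not on \<open>B\<close>, and which
  hits a \<open>\<delta>\<close>-neighbourhood of \<open>0\<close> with a probability bounded below, from every starting point in \<open>[-R, R]\<close>.

  Before each block the walk has only finitely many possible positions, so some \<open>R\<close> covers all of
  them, and then \<open>B\<close> is chosen above \<open>f\<close> at the end of the block and above all earlier steps. Aiming at every
  member of a countable family of small intervals in infinitely many blocks hits each of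
  them almost surely (\<open>hitting_steps\<close>), and this gives a dense range.

  Everything except the last part concerns finitely many signs, so probabilities are averages over
  the sign lists of a fixed length.
\<close>

section \<open>Averages over finite sign lists\<close>

definition signs :: "nat \<Rightarrow> real list set" where
  "signs n = {w. length w = n \<and> set w \<subseteq> {-1, 1}}"

definition sign_mean :: "nat \<Rightarrow> (real list \<Rightarrow> real) \<Rightarrow> real" where
  "sign_mean n F = (\<Sum>w\<in>signs n. F w) / 2 ^ n"

definition walk :: "(nat \<Rightarrow> real) \<Rightarrow> real list \<Rightarrow> nat \<Rightarrow> real" where
  "walk a w k = (\<Sum>i<k. w ! i * a i)"

lemma finite_signs [simp]: "finite (signs n)"
proof -
  have "signs n = {w. set w \<subseteq> {-1, 1} \<and> length w = n}" by (auto simp: signs_def)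
  then show ?thesis by (simp add: finite_lists_length_eq)
qed

lemma card_signs: "card (signs n) = 2 ^ n"
proof -
  have "signs n = {w. set w \<subseteq> {-1, 1} \<and> length w = n}" by (auto simp: signs_def)
  then show ?thesis by (simp add: card_lists_length_eq numeral_2_eq_2)
qed

lemma length_signs: "w \<in> signs n \<Longrightarrow> length w = n"
  by (simp add: signs_def)

lemma nth_signs: "w \<in> signs n \<Longrightarrow> i < n \<Longrightarrow> w ! i = -1 \<or> w ! i = 1"
  unfolding signs_def using nth_mem[of i w] by blast

text \<open>
  The fresh signs are independent of the past: averaging over a sign list is averaging over
  a prefix and then over the continuation. All conditioning is done through this identity.
\<close>

lemma sign_mean_append:
  "sign_mean (m + n) F = sign_mean m (\<lambda>u. sign_mean n (\<lambda>v. F (u @ v)))"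
proof -
  have inj: "inj_on (\<lambda>(u, v). u @ v) (signs m \<times> signs n)"
    by (auto simp: inj_on_def signs_def)
  have img: "signs (m + n) = (\<lambda>(u, v). u @ v) ` (signs m \<times> signs n)"
  proof (intro set_eqI iffI)
    fix w assume w: "w \<in> signs (m + n)"
    then have "take m w \<in> signs m" "drop m w \<in> signs n"
      by (auto simp: signs_def dest: in_set_takeD in_set_dropD)
    then show "w \<in> (\<lambda>(u, v). u @ v) ` (signs m \<times> signs n)"
      by (intro image_eqI[where x = "(take m w, drop m w)"]) auto
  qed (auto simp: signs_def)
  have "(\<Sum>w\<in>signs (m + n). F w) = (\<Sum>u\<in>signs m. \<Sum>v\<in>signs n. F (u @ v))"
    unfolding img sum.reindex[OF inj] sum.cartesian_product by (simp add: case_prod_unfold)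
  then show ?thesis
    by (simp add: sign_mean_def power_add sum_divide_distrib mult.commute)
qed

lemma signs_0: "signs 0 = {[]}"
  by (auto simp: signs_def)

lemma signs_1: "signs (Suc 0) = {[1], [-1]}"
  by (auto simp: signs_def length_Suc_conv)

lemma sign_mean_0: "sign_mean 0 F = F []"
  by (simp add: sign_mean_def signs_0)

lemma sign_mean_Cons:
  "sign_mean (Suc n) F = (sign_mean n (\<lambda>w. F (1 # w)) + sign_mean n (\<lambda>w. F (-1 # w))) / 2"
  using sign_mean_append[of "Suc 0" n F] by (simp add: sign_mean_def signs_1)

lemma sign_mean_snoc:
  "sign_mean (Suc n) F = sign_mean n (\<lambda>w. (F (w @ [1]) + F (w @ [-1])) / 2)"
  using sign_mean_append[of n "Suc 0" F] by (simp add: sign_mean_def signs_1)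

lemma sign_mean_mono:
  "(\<And>w. w \<in> signs n \<Longrightarrow> F w \<le> G w) \<Longrightarrow> sign_mean n F \<le> sign_mean n G"
  unfolding sign_mean_def by (intro divide_right_mono sum_mono) auto

lemma sign_mean_cong:
  "(\<And>w. w \<in> signs n \<Longrightarrow> F w = G w) \<Longrightarrow> sign_mean n F = sign_mean n G"
  unfolding sign_mean_def by simp

lemma sign_mean_const [simp]: "sign_mean n (\<lambda>w. c) = c"
  by (simp add: sign_mean_def card_signs)

lemma sign_mean_add: "sign_mean n (\<lambda>w. F w + G w) = sign_mean n F + sign_mean n G"
  by (simp add: sign_mean_def sum.distrib add_divide_distrib)

lemma sign_mean_diff: "sign_mean n (\<lambda>w. F w - G w) = sign_mean n F - sign_mean n G"
  by (simp add: sign_mean_def sum_subtractf diff_divide_distrib)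

lemma sign_mean_cmult: "sign_mean n (\<lambda>w. c * F w) = c * sign_mean n F"
  by (simp add: sign_mean_def sum_distrib_left)

lemma sign_mean_sum: "sign_mean n (\<lambda>w. \<Sum>j\<in>J. F j w) = (\<Sum>j\<in>J. sign_mean n (F j))"
  unfolding sign_mean_def by (simp add: sum.swap[of _ J] sum_divide_distrib)

lemma sign_mean_prefix:
  assumes "\<And>u v. u \<in> signs k \<Longrightarrow> v \<in> signs l \<Longrightarrow> F (u @ v) = G u"
  shows "sign_mean (k + l) F = sign_mean k G"
proof -
  have "sign_mean k (\<lambda>u. sign_mean l (\<lambda>v. F (u @ v))) = sign_mean k (\<lambda>u. sign_mean l (\<lambda>v. G u))"
    by (intro sign_mean_cong assms) auto
  then show ?thesis by (simp add: sign_mean_append)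
qed

lemma sign_mean_uminus: "sign_mean n (\<lambda>w. F (map uminus w)) = sign_mean n F"
proof -
  have "map uminus w \<in> signs n" if "w \<in> signs n" for w
  proof -
    have "- t \<in> {-1, 1}" if "t \<in> set w" for t
      using that \<open>w \<in> signs n\<close> unfolding signs_def by fastforce
    then show ?thesis using that by (auto simp: signs_def)
  qed
  then have "bij_betw (map uminus) (signs n) (signs n)"
    by (intro bij_betw_byWitness[where f' = "map uminus"]) (auto simp: o_def)
  then show ?thesis
    unfolding sign_mean_def by (simp add: sum.reindex_bij_betw)
qed

section \<open>The walk driven by a sign list and its moments\<close>

lemma walk_append_left: "k \<le> length u \<Longrightarrow> walk a (u @ v) k = walk a u k"
  unfolding walk_def by (intro sum.cong) (auto simp: nth_append)

lemma walk_append: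
  "walk a (u @ v) (length u + k) = walk a u (length u) + walk (\<lambda>i. a (length u + i)) v k"
proof -
  have "walk a (u @ v) (length u + k) = (\<Sum>i<length u. (u @ v) ! i * a i)
      + (\<Sum>i<k. (u @ v) ! (length u + i) * a (length u + i))"
    unfolding walk_def by (induction k) auto
  then show ?thesis
    by (simp add: walk_def nth_append)
qed

lemma walk_cong: "(\<And>i. i < k \<Longrightarrow> a i = b i) \<Longrightarrow> walk a w k = walk b w k"
  unfolding walk_def by simp

lemma walk_uminus: "k \<le> length w \<Longrightarrow> walk a (map uminus w) k = - walk a w k"
  unfolding walk_def by (simp add: sum_negf)

lemma walk_snoc: "length w = n \<Longrightarrow> walk a (w @ [s]) (Suc n) = walk a w n + s * a n"
  by (auto simp: walk_def nth_append)

lemma sign_mean_walk_sq: "sign_mean n (\<lambda>w. (walk a w n)\<^sup>2) = (\<Sum>i<n. (a i)\<^sup>2)"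
proof (induction n)
  case 0
  then show ?case by (simp add: sign_mean_0 walk_def)
next
  case (Suc n)
  have "sign_mean (Suc n) (\<lambda>w. (walk a w (Suc n))\<^sup>2) = sign_mean n (\<lambda>w. (walk a w n)\<^sup>2 + (a n)\<^sup>2)"
    unfolding sign_mean_snoc
    by (intro sign_mean_cong) (auto simp: walk_snoc length_signs power2_eq_square field_simps)
  then show ?case by (simp add: sign_mean_add Suc)
qed

text \<open>
  The Khinchine inequality for fourth moments. Adding an independent sign to a sum with variance
  \<open>s\<close> gives a fourth moment of at most \<open>3 s\<^sup>2 + 6 s c\<^sup>2 + c\<^sup>4\<close>, and this is below \<open>3 (s + c\<^sup>2)\<^sup>2\<close>.
\<close>

lemma sign_mean_walk_pow4:
  "sign_mean n (\<lambda>w. (walk a w n) ^ 4) \<le> 3 * (\<Sum>i<n. (a i)\<^sup>2)\<^sup>2"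
proof (induction n)
  case 0
  then show ?case by (simp add: sign_mean_0 walk_def)
next
  case (Suc n)
  let ?s = "\<Sum>i<n. (a i)\<^sup>2"
  have "sign_mean (Suc n) (\<lambda>w. (walk a w (Suc n)) ^ 4)
      = sign_mean n (\<lambda>w. (walk a w n) ^ 4 + 6 * (a n)\<^sup>2 * (walk a w n)\<^sup>2 + (a n) ^ 4)"
    unfolding sign_mean_snoc
    by (intro sign_mean_cong)
       (auto simp: walk_snoc length_signs power2_eq_square power4_eq_xxxx field_simps)
  also have "\<dots> = sign_mean n (\<lambda>w. (walk a w n) ^ 4) + 6 * (a n)\<^sup>2 * ?s + (a n) ^ 4"
    by (simp add: sign_mean_add sign_mean_cmult sign_mean_walk_sq)
  also have "\<dots> \<le> 3 * ?s\<^sup>2 + 6 * (a n)\<^sup>2 * ?s + 3 * (a n) ^ 4"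
  proof -
    have "0 \<le> (a n) ^ 4" by simp
    then show ?thesis using Suc by linarith
  qed
  also have "\<dots> = 3 * (\<Sum>i<Suc n. (a i)\<^sup>2)\<^sup>2"
    by (simp add: power2_eq_square power4_eq_xxxx algebra_simps)
  finally show ?case .
qed

text \<open>
  This is the Paley--Zygmund inequality: as the fourth moment is controlled by the square of the
  variance, the variance cannot come from a rare event alone. The pointwise inequality in the
  proof is the bound \<open>x\<^sup>2 \<le> x\<^sup>4 / (12 s) + 3 s\<close> of arithmetic and geometric means, used only where
  \<open>x\<^sup>2\<close> exceeds \<open>s / 2\<close>. Symmetry removes the absolute value at the cost of a factor \<open>1 / 2\<close>.
\<close>

lemma prob_walk_large:
  assumes "(\<Sum>i<n. (a i)\<^sup>2) \<ge> 2 * d\<^sup>2" "d > 0"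
  shows "sign_mean n (\<lambda>w. of_bool (walk a w n \<ge> d)) \<ge> 1 / 24"
proof -
  define s where "s = (\<Sum>i<n. (a i)\<^sup>2)"
  have s: "s \<ge> 2 * d\<^sup>2" "s > 0"
    using assms zero_less_power[OF assms(2), of 2] unfolding s_def by linarith+
  have pointwise: "x\<^sup>2 \<le> s / 2 + x ^ 4 / (12 * s) + 3 * s * (of_bool (x \<ge> d) + of_bool (- x \<ge> d))"
    for x
  proof (cases "x\<^sup>2 \<le> s / 2")
    case True
    then show ?thesis using s by (simp add: add_increasing2)
  next
    case False
    then have "d\<^sup>2 \<le> x\<^sup>2" using s by simp
    then have "\<bar>d\<bar> \<le> \<bar>x\<bar>" by (simp add: abs_le_square_iff)
    then have "of_bool (x \<ge> d) + of_bool (- x \<ge> d) \<ge> (1::real)"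
      using assms(2) by (auto simp: abs_if split: if_splits)
    then have "3 * s * (of_bool (x \<ge> d) + of_bool (- x \<ge> d)) \<ge> 3 * s"
      using s by simp
    moreover have "0 \<le> (x\<^sup>2 - 6 * s)\<^sup>2 / (12 * s)"
      using s by simp
    moreover have "(x\<^sup>2 - 6 * s)\<^sup>2 / (12 * s) = x ^ 4 / (12 * s) - x\<^sup>2 + 3 * s"
      using s by (simp add: field_simps power2_eq_square power4_eq_xxxx)
    ultimately show ?thesis using s by linarith
  qed
  define p where "p = sign_mean n (\<lambda>w. of_bool (walk a w n \<ge> d))"
  have "sign_mean n (\<lambda>w. of_bool (- walk a w n \<ge> d))
      = sign_mean n (\<lambda>w. of_bool (walk a (map uminus w) n \<ge> d))"
    by (intro sign_mean_cong) (simp add: walk_uminus length_signs)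
  also have "\<dots> = p"
    unfolding p_def by (rule sign_mean_uminus)
  finally have sym: "sign_mean n (\<lambda>w. of_bool (- walk a w n \<ge> d)) = p" .
  have "s = sign_mean n (\<lambda>w. (walk a w n)\<^sup>2)"
    by (simp add: sign_mean_walk_sq s_def)
  also have "\<dots> \<le> sign_mean n (\<lambda>w. s / 2 + (1 / (12 * s)) * (walk a w n) ^ 4
      + 3 * s * (of_bool (walk a w n \<ge> d) + of_bool (- walk a w n \<ge> d)))"
    using pointwise by (intro sign_mean_mono) simp
  also have "\<dots> = s / 2 + (1 / (12 * s)) * sign_mean n (\<lambda>w. (walk a w n) ^ 4) + 3 * s * (p + p)"
    unfolding sign_mean_add sign_mean_cmult sym p_def[symmetric] by simp
  also have "\<dots> \<le> s / 2 + (1 / (12 * s)) * (3 * s\<^sup>2) + 3 * s * (p + p)"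
    using sign_mean_walk_pow4[of n a] s by (intro add_mono mult_left_mono) (auto simp: s_def)
  also have "\<dots> = s * (3 / 4 + 6 * p)"
    using s by (simp add: field_simps power2_eq_square)
  finally have "3 / 4 + 6 * p \<ge> 1"
    using s by (simp add: mult_le_cancel_left1)
  then show ?thesis by (simp add: p_def)
qed

text \<open>
  Markov's inequality for the fourth moment. In the construction below the number of jumps to be
  controlled grows like the inverse of their variance, so that a Chebyshev bound with second moments would
  not suffice.
\<close>

lemma prob_walk_tail:
  assumes "D > 0"
  shows "sign_mean n (\<lambda>w. of_bool (\<bar>walk a w n\<bar> > D)) \<le> 3 * (\<Sum>i<n. (a i)\<^sup>2)\<^sup>2 / D ^ 4"
proof -
  have "of_bool (\<bar>x\<bar> > D) \<le> (1 / D ^ 4) * x ^ 4" for x :: real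
  proof (cases "\<bar>x\<bar> > D")
    case True
    then have "D ^ 4 \<le> \<bar>x\<bar> ^ 4" using assms by (intro power_mono) auto
    then show ?thesis using assms True by (simp add: power_even_abs)
  qed auto
  then have "sign_mean n (\<lambda>w. of_bool (\<bar>walk a w n\<bar> > D)) \<le> sign_mean n (\<lambda>w. (1 / D ^ 4) * (walk a w n) ^ 4)"
    by (intro sign_mean_mono)
  also have "\<dots> \<le> (1 / D ^ 4) * (3 * (\<Sum>i<n. (a i)\<^sup>2)\<^sup>2)"
    unfolding sign_mean_cmult using assms by (intro mult_left_mono sign_mean_walk_pow4) auto
  finally show ?thesis by simp
qed

section \<open>Recurrence of the simple random walk\<close>

definition avoid_zero :: "nat \<Rightarrow> int \<Rightarrow> real" where
  "avoid_zero r s = sign_mean r (\<lambda>w. of_bool (\<forall>k\<le>r. of_int s + walk (\<lambda>_. 1) w k \<noteq> 0))"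

lemma avoid_zero_0: "avoid_zero 0 s = of_bool (s \<noteq> 0)"
  by (simp add: avoid_zero_def sign_mean_0 walk_def)

lemma walk_Cons: "walk a (c # w) (Suc k) = c * a 0 + walk (\<lambda>i. a (Suc i)) w k"
  unfolding walk_def by (subst sum.lessThan_Suc_shift) simp

lemma avoid_zero_Suc:
  "avoid_zero (Suc r) s = (if s = 0 then 0 else (avoid_zero r (s + 1) + avoid_zero r (s - 1)) / 2)"
proof (cases "s = 0")
  case True
  then have "avoid_zero (Suc r) s = sign_mean (Suc r) (\<lambda>_. 0)"
    unfolding avoid_zero_def by (intro sign_mean_cong) (auto simp: walk_def intro!: exI[of _ 0])
  with True show ?thesis by simp
next
  case False
  have split: "(\<forall>k\<le>Suc r. P k) \<longleftrightarrow> P 0 \<and> (\<forall>k\<le>r. P (Suc k))" for P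
    by (metis Suc_le_mono not0_implies_Suc zero_le)
  have "walk (\<lambda>_. 1) w 0 = 0" for w by (simp add: walk_def)
  with False show ?thesis
    unfolding avoid_zero_def sign_mean_Cons split walk_Cons by (simp add: algebra_simps)
qed

lemma avoid_zero_bounds: "0 \<le> avoid_zero r s" "avoid_zero r s \<le> 1"
proof -
  show "0 \<le> avoid_zero r s"
    using sign_mean_mono[of r "\<lambda>_. 0"] unfolding avoid_zero_def by simp
  show "avoid_zero r s \<le> 1"
    using sign_mean_mono[of r _ "\<lambda>_. 1"] unfolding avoid_zero_def by simp
qed

lemma avoid_zero_uminus: "avoid_zero r (- s) = avoid_zero r s"
proof (induction r arbitrary: s)
  case (Suc r)
  have "- s + 1 = - (s - 1)" "- s - 1 = - (s + 1)" by simp_all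
  then have "avoid_zero r (- s + 1) = avoid_zero r (s - 1)" "avoid_zero r (- s - 1) = avoid_zero r (s + 1)"
    using Suc by metis+
  then show ?case unfolding avoid_zero_Suc by simp
qed (simp add: avoid_zero_0)

lemma avoid_zero_antimono: "avoid_zero (Suc r) s \<le> avoid_zero r s"
proof (induction r arbitrary: s)
  case 0
  then show ?case by (simp add: avoid_zero_Suc avoid_zero_0)
next
  case (Suc r)
  show ?case
    using Suc[of "s + 1"] Suc[of "s - 1"] avoid_zero_Suc[of "Suc r" s] avoid_zero_Suc[of r s] by auto
qed

text \<open>
  The limit as a function of the starting point vanishes at \<open>0\<close> and is harmonic elsewhere, so it
  is linear on the non-negative integers. A bounded linear function that vanishes at \<open>0\<close> is zero.
\<close>

lemma avoid_zero_tendsto_0: "(\<lambda>r. avoid_zero r s) \<longlonglongrightarrow> 0"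
proof -
  define l where "l = (\<lambda>s. lim (\<lambda>r. avoid_zero r s))"
  have lim: "(\<lambda>r. avoid_zero r s) \<longlonglongrightarrow> l s" for s
  proof -
    have "convergent (\<lambda>r. avoid_zero r s)"
      by (rule Bseq_monoseq_convergent)
         (auto intro!: BseqI'[of _ 1] decseq_imp_monoseq decseq_SucI avoid_zero_antimono
           simp: avoid_zero_bounds abs_le_iff intro: order_trans[OF _ avoid_zero_bounds(1)])
    then show ?thesis by (simp add: l_def convergent_LIMSEQ_iff)
  qed
  have l0: "l 0 = 0"
  proof -
    have "(\<lambda>r. avoid_zero (Suc r) 0) \<longlonglongrightarrow> l 0" using lim by (rule LIMSEQ_Suc)
    then show ?thesis by (simp add: avoid_zero_Suc LIMSEQ_const_iff)
  qed
  have harmonic: "l s = (l (s + 1) + l (s - 1)) / 2" if "s \<noteq> 0" for s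
  proof -
    have "(\<lambda>r. avoid_zero (Suc r) s) \<longlonglongrightarrow> l s" using lim by (rule LIMSEQ_Suc)
    moreover have "(\<lambda>r. avoid_zero (Suc r) s) \<longlonglongrightarrow> (l (s + 1) + l (s - 1)) / 2"
      using that by (auto simp: avoid_zero_Suc intro!: tendsto_intros lim)
    ultimately show ?thesis by (rule LIMSEQ_unique)
  qed
  have lin: "l (int n) = real n * l 1 \<and> l (int (Suc n)) = real (Suc n) * l 1" for n
  proof (induction n)
    case (Suc n)
    then show ?case using harmonic[of "int (Suc n)"] by (simp add: field_simps)
  qed (simp add: l0)
  have le1: "l s \<le> 1" for s
    using lim by (rule LIMSEQ_le_const2) (auto simp: avoid_zero_bounds)
  have ge0: "l s \<ge> 0" for s
    using lim by (rule LIMSEQ_le_const) (auto simp: avoid_zero_bounds)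
  have "l 1 = 0"
  proof (rule ccontr)
    assume "l 1 \<noteq> 0"
    then have "l 1 > 0" using ge0[of 1] by simp
    then obtain n where "1 < real n * l 1" using reals_Archimedean3 by blast
    then show False using lin[of n] le1[of "int n"] by simp
  qed
  then have nonneg: "l (int n) = 0" for n using lin by simp
  have "(\<lambda>r. avoid_zero r s) \<longlonglongrightarrow> 0" if "s \<ge> 0" for s
    using lim[of s] nonneg[of "nat s"] that by simp
  from this[of "\<bar>s\<bar>"] show ?thesis
    by (cases "s \<ge> 0") (auto simp: avoid_zero_uminus)
qed

lemma avoid_zero_uniformly_small:
  assumes "c > 0"
  shows "\<exists>r. \<forall>s. \<bar>s\<bar> \<le> int t \<longrightarrow> avoid_zero r s \<le> c"
proof -
  have "\<forall>\<^sub>F r in sequentially. \<forall>s\<in>{- int t..int t}. avoid_zero r s < c"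
    using order_tendstoD(2)[OF avoid_zero_tendsto_0 assms] by (intro eventually_ball_finite) auto
  then obtain r where "\<forall>s\<in>{- int t..int t}. avoid_zero r s < c"
    by (auto simp: eventually_sequentially)
  then show ?thesis by (intro exI[of _ r]) (auto simp: abs_le_iff intro!: less_imp_le)
qed

lemma walk_one_int:
  assumes "w \<in> signs n" "k \<le> n"
  obtains s where "walk (\<lambda>_. 1) w k = of_int s" "\<bar>s\<bar> \<le> int k"
proof -
  have "\<exists>s. walk (\<lambda>_. 1) w k = of_int s \<and> \<bar>s\<bar> \<le> int k"
    using assms(2)
  proof (induction k)
    case 0
    then show ?case by (simp add: walk_def)
  next
    case (Suc k)
    then obtain s where s: "walk (\<lambda>_. 1) w k = of_int s" "\<bar>s\<bar> \<le> int k" by auto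
    from nth_signs[OF assms(1), of k] Suc.prems
    consider "w ! k = -1" | "w ! k = 1" by auto
    then show ?case
    proof cases
      case 1
      then show ?thesis using s by (intro exI[of _ "s - 1"]) (auto simp: walk_def)
    next
      case 2
      then show ?thesis using s by (intro exI[of _ "s + 1"]) (auto simp: walk_def)
    qed
  qed
  then show ?thesis using that by blast
qed

text \<open>
  The simple random walk is at an integer of modulus at most \<open>t\<close> at time \<open>t\<close>, so a bound that is
  uniform over such starting points holds conditionally on the past.
\<close>

lemma no_return_prob:
  assumes "\<forall>s. \<bar>s\<bar> \<le> int t \<longrightarrow> avoid_zero r s \<le> c" "t + r \<le> m"
  shows "sign_mean m (\<lambda>w. of_bool (\<forall>k\<in>{t..t + r}. walk (\<lambda>_. 1) w k \<noteq> 0)) \<le> c"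
proof -
  let ?G = "\<lambda>w. of_bool (\<forall>k\<in>{t..t + r}. walk (\<lambda>_. 1) w k \<noteq> 0) :: real"
  obtain l where m: "m = t + r + l" using assms(2) le_Suc_ex by blast
  have "sign_mean (t + r + l) ?G = sign_mean (t + r) ?G"
    by (rule sign_mean_prefix) (auto simp: walk_append_left length_signs)
  also have "\<dots> = sign_mean t (\<lambda>u. sign_mean r (\<lambda>v. ?G (u @ v)))"
    by (rule sign_mean_append)
  also have "\<dots> \<le> sign_mean t (\<lambda>_. c)"
  proof (rule sign_mean_mono)
    fix u assume u: "u \<in> signs t"
    obtain s where s: "walk (\<lambda>_. 1) u t = of_int s" "\<bar>s\<bar> \<le> int t"
      using walk_one_int[OF u order_refl] by blast
    have len: "length u = t" using u by (rule length_signs)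
    have shift: "(\<forall>k\<in>{t..t + r}. P k) \<longleftrightarrow> (\<forall>k\<le>r. P (t + k))" for P
      by (metis atLeastAtMost_iff le_Suc_ex nat_add_left_cancel_le le_add1)
    have "walk (\<lambda>_. 1) (u @ v) (t + k) = of_int s + walk (\<lambda>_. 1) v k" for v k
      using walk_append[of "\<lambda>_. 1" u v k] s len by simp
    then have "sign_mean r (\<lambda>v. ?G (u @ v)) = avoid_zero r s"
      unfolding shift avoid_zero_def by simp
    then show "sign_mean r (\<lambda>v. ?G (u @ v)) \<le> c"
      using assms(1) s by simp
  qed
  finally show ?thesis by (simp add: m)
qed

section \<open>Blocks of nearly equal steps\<close>

lemma walk_add: "walk (\<lambda>i. a i + b i) w k = walk a w k + walk b w k"
  unfolding walk_def by (simp add: distrib_left sum.distrib)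

lemma walk_cmult: "walk (\<lambda>i. c * a i) w k = c * walk a w k"
  unfolding walk_def by (simp add: sum_distrib_left mult_ac)

lemma walk_const: "walk (\<lambda>_. c) w k = c * walk (\<lambda>_. 1) w k"
  using walk_cmult[of c "\<lambda>_. 1"] by simp

lemma walk_sum: "walk (\<lambda>i. \<Sum>j\<in>J. a j i) w k = (\<Sum>j\<in>J. walk (a j) w k)"
  unfolding walk_def by (simp add: sum_distrib_left sum.swap[of _ J])

lemma walk_before: "t \<le> k \<Longrightarrow> walk (\<lambda>i. of_bool (i < t)) w k = walk (\<lambda>_. 1) w t"
proof (induction k)
  case 0
  then show ?case by (simp add: walk_def)
next
  case (Suc k)
  show ?case
  proof (cases "t = Suc k")
    case True
    then show ?thesis by (simp add: walk_def)
  next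
    case False
    then show ?thesis using Suc by (simp add: walk_def)
  qed
qed

text \<open>
  Together with the expansion of a non-decreasing step sequence into its increments, this is
  summation by parts.
\<close>

lemma walk_after:
  "walk (\<lambda>i. of_bool (t \<le> i)) w k = of_bool (t \<le> k) * (walk (\<lambda>_. 1) w k - walk (\<lambda>_. 1) w t)"
  by (induction k) (auto simp: walk_def not_less_eq_eq le_Suc_eq intro!: Nat.gr0I)

lemma abs_walk_le:
  assumes "w \<in> signs n" "k \<le> n" "\<And>i. i < k \<Longrightarrow> \<bar>a i\<bar> \<le> c"
  shows "\<bar>walk a w k\<bar> \<le> real k * c"
proof -
  have "\<bar>w ! i * a i\<bar> \<le> c" if "i < k" for i
    using nth_signs[OF assms(1), of i] that assms(2,3) by (auto simp: abs_mult)
  then have "(\<Sum>i<k. \<bar>w ! i * a i\<bar>) \<le> real (card {..<k}) * c"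
    by (intro sum_bounded_above) auto
  with sum_abs[of "\<lambda>i. w ! i * a i" "{..<k}"] show ?thesis
    unfolding walk_def card_lessThan by (rule order_trans)
qed

text \<open>
  The discrete intermediate value theorem.
\<close>

lemma small_jumps_hit:
  fixes V :: "nat \<Rightarrow> real"
  assumes "V 0 \<le> d" "d \<le> V N" "\<And>j. j < N \<Longrightarrow> \<bar>V (Suc j) - V j\<bar> \<le> D" "D \<ge> 0"
  shows "\<exists>j\<le>N. \<bar>V j - d\<bar> \<le> D"
  using assms(2,3)
proof (induction N)
  case 0
  then show ?case using assms by auto
next
  case (Suc N)
  show ?case
  proof (cases "d \<le> V N")
    case True
    then show ?thesis using Suc by (meson le_SucI less_SucI)
  next
    case False
    with Suc.prems(1) Suc.prems(2)[of N] have "\<bar>V (Suc N) - d\<bar> \<le> D" by auto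
    then show ?thesis by blast
  qed
qed

text \<open>
  Summation by parts for steps \<open>B + E i + \<kappa> i\<close>, where \<open>E\<close> increases by \<open>e i\<close> at the time \<open>t i\<close>. At
  a time when the simple random walk \<open>S\<close> is back at \<open>0\<close>, the large common part \<open>B\<close> has cancelled,
  and the change of \<open>E\<close> at \<open>t i\<close> has left the displacement \<open>- e i * S (t i)\<close>. If \<open>k\<close> is itself a
  switching time \<open>t i\<close>, the increments made there contribute nothing since \<open>S k = 0\<close>.
\<close>

lemma phased_walk_at_return:
  fixes t :: "nat \<Rightarrow> nat" and e :: "nat \<Rightarrow> real"
  assumes t: "mono t" and j: "j < N" "t j \<le> k" "k \<le> t (Suc j)" and S_k: "walk (\<lambda>_. 1) w k = 0"
  shows "walk (\<lambda>i. B + ((\<Sum>i'<N. e i' * of_bool (t i' \<le> i)) + \<kappa> * real i)) w k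
    = (\<Sum>i<Suc j. - e i * walk (\<lambda>_. 1) w (t i)) + \<kappa> * walk real w k"
proof -
  define S where "S = walk (\<lambda>_. 1) w"
  have S_0: "S k = 0" using S_k by (simp add: S_def)
  have "walk (\<lambda>i. B + ((\<Sum>i'<N. e i' * of_bool (t i' \<le> i)) + \<kappa> * real i)) w k
      = B * S k + ((\<Sum>i<N. e i * (of_bool (t i \<le> k) * (S k - S (t i)))) + \<kappa> * walk real w k)"
    unfolding walk_add walk_sum walk_cmult walk_after S_def walk_const[of B] ..
  also have "\<dots> = (\<Sum>i<N. of_bool (t i \<le> k) * (- e i * S (t i))) + \<kappa> * walk real w k"
    using S_0 by (auto intro!: sum.cong)
  also have "(\<Sum>i<N. of_bool (t i \<le> k) * (- e i * S (t i))) = (\<Sum>i<Suc j. - e i * S (t i))"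
  proof (rule sum.mono_neutral_cong_right)
    show "\<forall>i\<in>{..<N} - {..<Suc j}. of_bool (t i \<le> k) * (- e i * S (t i)) = 0"
    proof
      fix i assume "i \<in> {..<N} - {..<Suc j}"
      then have "k \<le> t i" using monoD[OF t, of "Suc j" i] j by auto
      then show "of_bool (t i \<le> k) * (- e i * S (t i)) = 0"
        using S_0 by (cases "t i = k") auto
    qed
    show "of_bool (t i \<le> k) * (- e i * S (t i)) = - e i * S (t i)" if "i \<in> {..<Suc j}" for i
      using monoD[OF t, of i j] that j by auto
  qed (use j in auto)
  finally show ?thesis by (simp add: S_def)
qed

lemma sign_mean_exceptions:
  fixes A G :: "real list \<Rightarrow> bool" and X Y :: "nat \<Rightarrow> real list \<Rightarrow> bool"
  assumes "\<And>w. w \<in> signs n \<Longrightarrow> G w \<Longrightarrow> A w \<Longrightarrow> \<exists>j<N. X j w \<or> Y j w"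
  shows "sign_mean n (\<lambda>w. of_bool (A w)) \<le> (1 - sign_mean n (\<lambda>w. of_bool (G w)))
    + ((\<Sum>j<N. sign_mean n (\<lambda>w. of_bool (X j w))) + (\<Sum>j<N. sign_mean n (\<lambda>w. of_bool (Y j w))))"
proof -
  have union: "of_bool (\<exists>j<N. P j) \<le> (\<Sum>j<N. of_bool (P j) :: real)" for P :: "nat \<Rightarrow> bool"
  proof (cases "\<exists>j<N. P j")
    case True
    then obtain j where "j < N" "P j" by blast
    then show ?thesis
      using member_le_sum[of j "{..<N}" "\<lambda>j. of_bool (P j) :: real"] by auto
  qed (simp add: sum_nonneg)
  have "sign_mean n (\<lambda>w. of_bool (A w)) \<le> sign_mean n (\<lambda>w. (1 - of_bool (G w))
      + ((\<Sum>j<N. of_bool (X j w)) + (\<Sum>j<N. of_bool (Y j w))))"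
  proof (rule sign_mean_mono)
    fix w assume "w \<in> signs n"
    then have "of_bool (A w) \<le> (1 - of_bool (G w))
        + (of_bool (\<exists>j<N. X j w) + of_bool (\<exists>j<N. Y j w) :: real)"
      using assms[of w] by (auto simp: of_bool_def)
    then show "of_bool (A w) \<le> (1 - of_bool (G w))
        + ((\<Sum>j<N. of_bool (X j w)) + (\<Sum>j<N. of_bool (Y j w)) :: real)"
      using union[of "\<lambda>j. X j w"] union[of "\<lambda>j. Y j w"] by linarith
  qed
  then show ?thesis
    by (simp only: sign_mean_add sign_mean_diff sign_mean_sum sign_mean_const)
qed

text \<open>
  The length \<open>m\<close> is fixed before the lower bound \<open>B\<close> for the steps. This order of the quantifiers is
  what allows a block to lie above \<open>f\<close>: the last index of the block is known when \<open>B\<close> is chosen.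
  
  The times \<open>t 0 < \<dots> < t N\<close> grow so fast that the simple random walk \<open>S\<close> very likely returns to \<open>0\<close>
  in each phase between consecutive times. At such a return in phase \<open>j\<close> the walk has the
  displacement \<open>V (Suc j)\<close>, up to an error of \<open>D\<close>, so it suffices that \<open>x + V j\<close> comes within \<open>D\<close> of \<open>0\<close>
  for some \<open>j\<close>. With \<open>e j\<close> of size \<open>\<eta> / sqrt (t j)\<close> every jump of \<open>V\<close> has variance \<open>\<eta>\<^sup>2\<close>. The jumps
  are positively correlated, so \<open>V N\<close> has variance at least \<open>N \<eta>\<^sup>2 = 2 R\<^sup>2\<close> and lies beyond \<open>- x\<close> with
  probability at least \<open>1 / 24\<close>. On the other hand, all jumps are at most \<open>D\<close> up to probability
  \<open>3 N \<eta>\<^sup>4 / D\<^sup>4\<close>, which is of order \<open>1 / N\<close>. A path with small jumps cannot cross \<open>- x\<close> without coming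
  close to it.
\<close>

lemma hitting_block:
  fixes R \<delta> :: real
  assumes "R > 0" "\<delta> > 0"
  shows "\<exists>m>0. \<forall>B. \<exists>b. strict_mono b \<and> B \<le> b 0 \<and>
    (\<forall>x. \<bar>x\<bar> \<le> R \<longrightarrow> sign_mean m (\<lambda>w. of_bool (\<forall>k\<le>m. \<bar>x + walk b w k\<bar> > \<delta>)) \<le> 47 / 48)"
proof -
  define D where "D = \<delta> / 2"
  have D: "D > 0" using assms by (simp add: D_def)
  (* The bound makes 3 N \<eta>^4 / D^4 = 12 R^4 / (N D^4) at most 1 / 96. *)
  obtain N :: nat where N: "N > 0" "real N \<ge> 1152 * R ^ 4 / D ^ 4"
  proof -
    obtain n :: nat where "1152 * R ^ 4 / D ^ 4 \<le> real n" using real_arch_simple by blast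
    then show ?thesis using that[of "Suc n"] by simp
  qed
  define \<eta> where "\<eta> = sqrt (2 * R\<^sup>2 / N)"
  have \<eta>: "\<eta> > 0" "\<eta>\<^sup>2 = 2 * R\<^sup>2 / N" using assms N by (auto simp: \<eta>_def)
  have "\<exists>r. \<forall>s. \<bar>s\<bar> \<le> int t \<longrightarrow> avoid_zero r s \<le> 1 / (96 * N)" for t
    using N by (intro avoid_zero_uniformly_small) simp
  then obtain r where r: "\<And>t s. \<bar>s\<bar> \<le> int t \<Longrightarrow> avoid_zero (r t) s \<le> 1 / (96 * N)"
    by metis
  define t where "t = rec_nat 1 (\<lambda>_ u. u + r u)"
  have t_0: "t 0 = 1" and t_Suc: "t (Suc j) = t j + r (t j)" for j
    by (simp_all add: t_def)
  have t_mono: "i \<le> j \<Longrightarrow> t i \<le> t j" for i j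
    by (rule lift_Suc_mono_le) (auto simp: t_Suc)
  have t_pos: "t j \<ge> 1" for j using t_mono[of 0 j] t_0 by simp
  define m where "m = t N"
  have m: "m > 0" using t_pos[of N] by (simp add: m_def)
  define e where "e = (\<lambda>j. \<eta> / sqrt (t j))"
  have e_pos: "e j > 0" for j using \<eta> t_pos[of j] by (simp add: e_def)
  have e_sq: "(e j)\<^sup>2 * t j = \<eta>\<^sup>2" for j
    using t_pos[of j] by (simp add: e_def power_divide)
  (* The slope \<kappa> makes the steps strictly increasing; over the whole block it moves the walk
     by at most \<kappa> m^2 = D. *)
  define \<kappa> where "\<kappa> = D / m\<^sup>2"
  have \<kappa>: "\<kappa> > 0" using D m by (simp add: \<kappa>_def)
  define S where "S = walk (\<lambda>_. 1)"
  define V where "V = (\<lambda>w n. \<Sum>j<n. - e j * S w (t j))"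

  have V_walk: "- V w N = walk (\<lambda>i. \<Sum>j<N. e j * of_bool (i < t j)) w m" for w
  proof -
    have "walk (\<lambda>i. \<Sum>j<N. e j * of_bool (i < t j)) w m
        = (\<Sum>j<N. e j * walk (\<lambda>i. of_bool (i < t j)) w m)"
      by (simp only: walk_sum walk_cmult)
    also have "\<dots> = (\<Sum>j<N. e j * S w (t j))"
      unfolding S_def m_def by (intro sum.cong) (auto simp: walk_before t_mono)
    finally show ?thesis by (simp add: V_def sum_negf)
  qed
  have variance: "(\<Sum>i<m. (\<Sum>j<N. e j * of_bool (i < t j))\<^sup>2) \<ge> 2 * R\<^sup>2"
  proof -
    (* Dropping the mixed terms is the use of the positive correlation. *)
    have sq: "(\<Sum>j<n. c j)\<^sup>2 \<ge> (\<Sum>j<n. (c j)\<^sup>2)" if "\<And>j. c j \<ge> 0" for c :: "nat \<Rightarrow> real" and n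
    proof (induction n)
      case (Suc n)
      have "0 \<le> (\<Sum>j<n. c j) * c n" using that by (simp add: sum_nonneg)
      then show ?case using Suc by (simp add: power2_sum)
    qed simp
    have cnt: "(\<Sum>i<m. of_bool (i < t j)) = real (t j)" if "j < N" for j
    proof -
      have "{..<m} \<inter> {i. i < t j} = {..<t j}" using t_mono[of j N] that by (auto simp: m_def)
      then show ?thesis by (simp add: of_bool_def sum.If_cases)
    qed
    have "2 * R\<^sup>2 = (\<Sum>j<N. \<eta>\<^sup>2)" using N \<eta> by simp
    also have "\<dots> = (\<Sum>j<N. (e j)\<^sup>2 * (\<Sum>i<m. of_bool (i < t j)))"
      by (intro sum.cong refl) (simp only: cnt e_sq lessThan_iff)
    also have "\<dots> = (\<Sum>j<N. \<Sum>i<m. (e j * of_bool (i < t j))\<^sup>2)"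
      unfolding sum_distrib_left by (intro sum.cong refl) (auto simp: of_bool_def)
    also have "\<dots> = (\<Sum>i<m. \<Sum>j<N. (e j * of_bool (i < t j))\<^sup>2)"
      by (rule sum.swap)
    also have "\<dots> \<le> (\<Sum>i<m. (\<Sum>j<N. e j * of_bool (i < t j))\<^sup>2)"
      using e_pos by (intro sum_mono sq) (simp add: less_imp_le)
    finally show ?thesis .
  qed
  (* One of the two directions is needed for x \<le> 0, the other one for x > 0. *)
  have reach_neg: "sign_mean m (\<lambda>w. of_bool (- V w N \<ge> R)) \<ge> 1 / 24"
    unfolding V_walk using variance assms by (intro prob_walk_large) auto
  have "sign_mean m (\<lambda>w. of_bool (V w N \<ge> R)) = sign_mean m (\<lambda>w. of_bool (- V (map uminus w) N \<ge> R))"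
  proof (intro sign_mean_cong)
    fix w assume "w \<in> signs m"
    then have "V (map uminus w) N = - V w N"
      using V_walk[of w] V_walk[of "map uminus w"] walk_uminus[of m w] length_signs by fastforce
    then show "of_bool (V w N \<ge> R) = (of_bool (- V (map uminus w) N \<ge> R) :: real)" by simp
  qed
  then have reach_pos: "sign_mean m (\<lambda>w. of_bool (V w N \<ge> R)) \<ge> 1 / 24"
    using reach_neg sign_mean_uminus[of m "\<lambda>w. of_bool (- V w N \<ge> R)"] by simp

  have jump: "sign_mean m (\<lambda>w. of_bool (\<bar>e j * S w (t j)\<bar> > D)) \<le> 1 / (96 * N)" if "j < N" for j
  proof -
    have tm: "t j \<le> m" using t_mono[of j N] that by (simp add: m_def)
    have "e j * S w (t j) = walk (\<lambda>i. e j * of_bool (i < t j)) w m" for w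
      using tm by (simp add: walk_cmult walk_before S_def)
    then have "sign_mean m (\<lambda>w. of_bool (\<bar>e j * S w (t j)\<bar> > D))
        \<le> 3 * (\<Sum>i<m. (e j * of_bool (i < t j))\<^sup>2)\<^sup>2 / D ^ 4"
      using prob_walk_tail[OF D] by simp
    also have "(\<Sum>i<m. (e j * of_bool (i < t j))\<^sup>2) = (e j)\<^sup>2 * t j"
    proof -
      have "{..<m} \<inter> {i. i < t j} = {..<t j}" using tm by auto
      then show ?thesis
        by (simp add: of_bool_def sum.If_cases power_mult_distrib if_distrib[of "\<lambda>x. x\<^sup>2"] 
            if_distrib[of "\<lambda>x. _ * x"] cong: if_cong)
    qed
    also have "3 * ((e j)\<^sup>2 * t j)\<^sup>2 / D ^ 4 = (12 * R ^ 4 / D ^ 4) / N\<^sup>2"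
      unfolding e_sq \<eta> by (simp add: power2_eq_square power4_eq_xxxx mult_ac)
    also have "\<dots> \<le> (N / 96) / N\<^sup>2"
      using N(2) by (intro divide_right_mono) auto
    also have "\<dots> = 1 / (96 * N)" using N by (simp add: power2_eq_square)
    finally show ?thesis .
  qed

  have return: "sign_mean m (\<lambda>w. of_bool (\<forall>k\<in>{t j..t (Suc j)}. S w k \<noteq> 0)) \<le> 1 / (96 * N)"
    if "j < N" for j
    unfolding S_def t_Suc using r t_mono[of "Suc j" N] that
    by (intro no_return_prob) (auto simp: m_def t_Suc)

  show ?thesis
  proof (intro exI[of _ m] conjI m allI)
    fix B :: real
    define b where "b = (\<lambda>i. B + ((\<Sum>j<N. e j * of_bool (t j \<le> i)) + \<kappa> * real i))"
    have "b i < b (Suc i)" for i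
      unfolding b_def using \<kappa> e_pos
      by (intro add_strict_left_mono add_le_less_mono sum_mono mult_left_mono) (auto simp: less_imp_le)
    then have mono: "strict_mono b" by (simp add: strict_mono_Suc_iff)
    have "0 \<le> (\<Sum>j<N. e j * of_bool (t j \<le> 0))"
      using e_pos by (intro sum_nonneg) (simp add: less_imp_le)
    then have b_0: "B \<le> b 0" by (simp add: b_def)
    have at_return: "\<bar>walk b w k - V w (Suc j)\<bar> \<le> D"
      if w: "w \<in> signs m" and j: "j < N" "k \<in> {t j..t (Suc j)}" "S w k = 0" for w j k
    proof -
      have km: "k \<le> m" using j t_mono[of "Suc j" N] by (auto simp: m_def)
      have "mono t" using t_mono by (rule monoI)
      then have "walk b w k - V w (Suc j) = \<kappa> * walk real w k"
        using phased_walk_at_return[of t j N k w B e \<kappa>] j by (simp add: V_def b_def S_def)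
      moreover have "\<bar>walk real w k\<bar> \<le> real m * real m"
        using w km by (intro order_trans[OF abs_walk_le mult_right_mono]) auto
      then have "\<bar>\<kappa> * walk real w k\<bar> \<le> \<kappa> * (real m * real m)"
        unfolding abs_mult using \<kappa>
        by (intro mult_mono) auto
      moreover have "\<kappa> * (real m * real m) = D"
        using m by (simp add: \<kappa>_def power2_eq_square)
      ultimately show ?thesis by simp
    qed
    have hit: "\<exists>k\<le>m. \<bar>x + walk b w k\<bar> \<le> \<delta>"
      if w: "w \<in> signs m" and x: "\<bar>x\<bar> \<le> R" and far: "if x \<le> 0 then V w N \<ge> R else - V w N \<ge> R"
        and small: "\<forall>j<N. \<bar>e j * S w (t j)\<bar> \<le> D" and ret: "\<forall>j<N. \<exists>k\<in>{t j..t (Suc j)}. S w k = 0"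
      for w x
    proof -
      have step: "\<bar>V w (Suc j) - V w j\<bar> \<le> D" if "j < N" for j
        using small that by (simp add: V_def)
      have "\<exists>j\<le>N. \<bar>x + V w j\<bar> \<le> D"
      proof (cases "x \<le> 0")
        case True
        have "\<exists>j\<le>N. \<bar>V w j - (- x)\<bar> \<le> D"
          using True far x step D by (intro small_jumps_hit) (auto simp: V_def)
        then show ?thesis by (simp add: add.commute)
      next
        case False
        have "\<exists>j\<le>N. \<bar>- V w j - x\<bar> \<le> D"
        proof (rule small_jumps_hit)
          fix j assume "j < N"
          from step[OF this] show "\<bar>- V w (Suc j) - - V w j\<bar> \<le> D" by linarith
        qed (use False far x D in \<open>auto simp: V_def\<close>)
        then obtain j where "j \<le> N" "\<bar>- V w j - x\<bar> \<le> D" by blast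
        then show ?thesis by (intro exI[of _ j]) linarith
      qed
      then obtain j where j: "j \<le> N" "\<bar>x + V w j\<bar> \<le> D" by blast
      show ?thesis
      proof (cases j)
        case 0
        then show ?thesis using j D by (intro exI[of _ 0]) (simp add: V_def walk_def D_def)
      next
        case (Suc i)
        then obtain k where k: "k \<in> {t i..t (Suc i)}" "S w k = 0" using ret j Suc_le_eq by blast
        with at_return[OF w, of i k] Suc j have "\<bar>x + walk b w k\<bar> \<le> D + D" by auto
        moreover have "k \<le> m" using k Suc j t_mono[of "Suc i" N] by (auto simp: m_def)
        ultimately show ?thesis by (auto simp: D_def)
      qed
    qed
    have "sign_mean m (\<lambda>w. of_bool (\<forall>k\<le>m. \<bar>x + walk b w k\<bar> > \<delta>)) \<le> 47 / 48" if x: "\<bar>x\<bar> \<le> R" for x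
    proof -
      let ?far = "\<lambda>w. if x \<le> 0 then V w N \<ge> R else - V w N \<ge> R"
      have far: "sign_mean m (\<lambda>w. of_bool (?far w)) \<ge> 1 / 24"
        using reach_pos reach_neg by (cases "x \<le> 0"; simp)
      have "sign_mean m (\<lambda>w. of_bool (\<forall>k\<le>m. \<bar>x + walk b w k\<bar> > \<delta>))
          \<le> (1 - sign_mean m (\<lambda>w. of_bool (?far w)))
            + ((\<Sum>j<N. sign_mean m (\<lambda>w. of_bool (\<bar>e j * S w (t j)\<bar> > D)))
              + (\<Sum>j<N. sign_mean m (\<lambda>w. of_bool (\<forall>k\<in>{t j..t (Suc j)}. S w k \<noteq> 0))))"
      proof (rule sign_mean_exceptions)
        fix w assume w: "w \<in> signs m" "?far w" "\<forall>k\<le>m. \<bar>x + walk b w k\<bar> > \<delta>"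
        show "\<exists>j<N. \<bar>e j * S w (t j)\<bar> > D \<or> (\<forall>k\<in>{t j..t (Suc j)}. S w k \<noteq> 0)"
        proof (rule ccontr)
          assume none: "\<not> ?thesis"
          have "\<forall>j<N. \<bar>e j * S w (t j)\<bar> \<le> D" using none by (blast intro: leI)
          moreover have "\<forall>j<N. \<exists>k\<in>{t j..t (Suc j)}. S w k = 0" using none by blast
          ultimately obtain k where "k \<le> m" "\<bar>x + walk b w k\<bar> \<le> \<delta>"
            using hit[OF w(1) x w(2)] by blast
          then show False using w(3) by (simp add: not_le[symmetric])
        qed
      qed
      also have "\<dots> \<le> (1 - 1 / 24) + ((\<Sum>j<N. 1 / (96 * N)) + (\<Sum>j<N. 1 / (96 * N)))"
        using far jump return by (intro add_mono diff_mono sum_mono) simp_all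
      also have "\<dots> = 47 / 48" using N by simp
      finally show ?thesis .
    qed
    with mono b_0 show "\<exists>b. strict_mono b \<and> B \<le> b 0 \<and>
        (\<forall>x. \<bar>x\<bar> \<le> R \<longrightarrow> sign_mean m (\<lambda>w. of_bool (\<forall>k\<le>m. \<bar>x + walk b w k\<bar> > \<delta>)) \<le> 47 / 48)"
      by blast
  qed
qed

section \<open>Concatenating blocks\<close>

text \<open>
  The finitely many sign patterns of the past leave the walk in a bounded set, so one block
  serves all of them at once: the bound holds conditionally on every past \<open>u\<close>.
\<close>

lemma extend_by_block:
  fixes f a :: "nat \<Rightarrow> real" and y \<delta> :: real
  assumes f: "mono_on {1..} f" and "\<delta> > 0"
    and a: "strict_mono_on {..<n} a" "\<forall>i<n. 0 \<le> a i \<and> f (Suc i) \<le> a i"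
  shows "\<exists>a' m. m > 0 \<and> strict_mono_on {..<n + m} a' \<and> (\<forall>i<n + m. 0 \<le> a' i \<and> f (Suc i) \<le> a' i) \<and>
    (\<forall>i<n. a' i = a i) \<and>
    (\<forall>u\<in>signs n. sign_mean m (\<lambda>v. of_bool (\<forall>k\<in>{n..n + m}. \<bar>walk a' (u @ v) k - y\<bar> > \<delta>)) \<le> 47 / 48)"
proof -
  define c where "c = (\<Sum>i<n. \<bar>a i\<bar>)"
  have c: "\<bar>a i\<bar> \<le> c" if "i < n" for i
    unfolding c_def using that by (intro member_le_sum) auto
  have c0: "c \<ge> 0" by (simp add: c_def sum_nonneg)
  define R where "R = real n * c + \<bar>y\<bar> + 1"
  have "R > 0" using c0 by (simp add: R_def add_nonneg_pos)
  from hitting_block[OF this \<open>\<delta> > 0\<close>] obtain m where m: "m > 0"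
    and ex: "\<And>B. \<exists>b. strict_mono b \<and> B \<le> b 0 \<and>
      (\<forall>x. \<bar>x\<bar> \<le> R \<longrightarrow> sign_mean m (\<lambda>w. of_bool (\<forall>k\<le>m. \<bar>x + walk b w k\<bar> > \<delta>)) \<le> 47 / 48)"
    by blast
  obtain b where b: "strict_mono b" "c + 1 + \<bar>f (n + m)\<bar> \<le> b 0"
    and hits: "\<And>x. \<bar>x\<bar> \<le> R \<Longrightarrow> sign_mean m (\<lambda>w. of_bool (\<forall>k\<le>m. \<bar>x + walk b w k\<bar> > \<delta>)) \<le> 47 / 48"
    using ex[of "c + 1 + \<bar>f (n + m)\<bar>"] by blast
  have b_ge: "c + 1 + \<bar>f (n + m)\<bar> \<le> b i" for i
    using b strict_mono_less_eq[OF b(1), of 0 i] by simp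
  define a' where "a' = (\<lambda>i. if i < n then a i else b (i - n))"
  have "a' i < a' j" if "i < j" "j < n + m" for i j
  proof -
    consider "j < n" | "i < n" "n \<le> j" | "n \<le> i" using that by linarith
    then show ?thesis
    proof cases
      case 1
      then show ?thesis using that strict_mono_onD[OF a(1), of i j] by (simp add: a'_def)
    next
      case 2
      then show ?thesis using c[of i] b_ge[of "j - n"] by (simp add: a'_def)
    next
      case 3
      then show ?thesis using that strict_monoD[OF b(1), of "i - n" "j - n"] by (simp add: a'_def)
    qed
  qed
  then have mono: "strict_mono_on {..<n + m} a'" by (intro strict_mono_onI) auto
  have ge: "0 \<le> a' i \<and> f (Suc i) \<le> a' i" if "i < n + m" for i
  proof (cases "i < n")
    case False
    have "f (Suc i) \<le> f (n + m)" using that by (intro mono_onD[OF f]) auto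
    then have "0 \<le> b (i - n)" "f (Suc i) \<le> b (i - n)" using b_ge[of "i - n"] c0 by linarith+
    then show ?thesis using False by (simp add: a'_def)
  qed (use a(2) in \<open>simp add: a'_def\<close>)
  have block: "sign_mean m (\<lambda>v. of_bool (\<forall>k\<in>{n..n + m}. \<bar>walk a' (u @ v) k - y\<bar> > \<delta>)) \<le> 47 / 48"
    if u: "u \<in> signs n" for u
  proof -
    have len: "length u = n" using u by (rule length_signs)
    have "\<bar>walk a u n\<bar> \<le> real n * c" using u c by (intro abs_walk_le) auto
    then have small: "\<bar>walk a u n - y\<bar> \<le> R" by (simp add: R_def)
    have "walk a' u n = walk a u n" by (intro walk_cong) (simp add: a'_def)
    moreover have "(\<lambda>i. a' (n + i)) = b" by (auto simp: a'_def)
    ultimately have walk: "walk a' (u @ v) (n + k) - y = (walk a u n - y) + walk b v k" for v k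
      using walk_append[of a' u v k] len by simp
    have shift: "(\<forall>k\<in>{n..n + m}. P k) \<longleftrightarrow> (\<forall>k\<le>m. P (n + k))" for P
      by (metis atLeastAtMost_iff le_Suc_ex nat_add_left_cancel_le le_add1)
    show ?thesis unfolding shift walk by (rule hits[OF small])
  qed
  show ?thesis
    using m mono ge block by (intro exI[of _ a'] exI[of _ m]) (auto simp: a'_def)
qed

text \<open>
  Block \<open>j\<close> aims at the target with index \<open>\<tau> j\<close>, and \<open>\<tau>\<close> takes every value infinitely often. Each attempt
  fails with conditional probability at most \<open>47 / 48\<close>, so the probability that all attempts at a fixed
  target fail is zero.
\<close>

lemma hitting_steps:
  fixes f y \<delta> :: "nat \<Rightarrow> real"
  assumes f: "mono_on {1..} f" and \<delta>: "\<And>i. \<delta> i > 0"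
  shows "\<exists>a. strict_mono a \<and> (\<forall>i. 0 \<le> a i \<and> f (Suc i) \<le> a i) \<and>
    (\<forall>i. \<forall>c>0. \<exists>n. sign_mean n (\<lambda>w. of_bool (\<forall>k\<le>n. \<bar>walk a w k - y i\<bar> > \<delta> i)) < c)"
proof -
  define \<tau> :: "nat \<Rightarrow> nat" where "\<tau> = (\<lambda>j. fst (prod_decode j))"
  define good where "good = (\<lambda>(_::nat) (a, n). strict_mono_on {..<n} a \<and> (\<forall>i<n. 0 \<le> a i \<and> f (Suc i) \<le> (a i :: real)))"
  define next_block where "next_block = (\<lambda>j (a :: nat \<Rightarrow> real, n) (a', n'). n < n' \<and> (\<forall>i<n. a' i = a i) \<and>
    (\<forall>u\<in>signs n. sign_mean (n' - n)
      (\<lambda>v. of_bool (\<forall>k\<in>{n..n'}. \<bar>walk a' (u @ v) k - y (\<tau> j)\<bar> > \<delta> (\<tau> j))) \<le> 47 / 48))"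
  have "\<exists>s. \<forall>j. good j (s j) \<and> next_block j (s j) (s (Suc j))"
  proof (rule dependent_nat_choice)
    show "\<exists>s. good 0 s"
      by (rule exI[of _ "(\<lambda>_. 0, 0)"]) (simp add: good_def strict_mono_on_def)
  next
    fix s j assume s: "good j s"
    obtain a n where [simp]: "s = (a, n)" by (cases s)
    obtain a' m where "m > 0" "strict_mono_on {..<n + m} a'" "\<forall>i<n + m. 0 \<le> a' i \<and> f (Suc i) \<le> a' i"
      "\<forall>i<n. a' i = a i"
      "\<forall>u\<in>signs n. sign_mean m (\<lambda>v. of_bool (\<forall>k\<in>{n..n + m}. \<bar>walk a' (u @ v) k - y (\<tau> j)\<bar> > \<delta> (\<tau> j))) \<le> 47 / 48"
      using extend_by_block[OF f \<delta>, of n a "\<tau> j" "y (\<tau> j)"] s by (auto simp: good_def)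
    then show "\<exists>s'. good (Suc j) s' \<and> next_block j s s'"
      by (intro exI[of _ "(a', n + m)"]) (simp add: good_def next_block_def)
  qed
  then obtain s where s: "\<And>j. good j (s j)" "\<And>j. next_block j (s j) (s (Suc j))" by blast
  define A where "A = (\<lambda>j. fst (s j))"
  define N where "N = (\<lambda>j. snd (s j))"
  have A_good: "strict_mono_on {..<N j} (A j)" "i < N j \<Longrightarrow> 0 \<le> A j i \<and> f (Suc i) \<le> A j i" for i j
    using s(1)[of j] by (auto simp: good_def A_def N_def case_prod_unfold)
  have N_less: "N j < N (Suc j)" and A_Suc: "i < N j \<Longrightarrow> A (Suc j) i = A j i"
    and A_hits: "u \<in> signs (N j) \<Longrightarrow> sign_mean (N (Suc j) - N j)
      (\<lambda>v. of_bool (\<forall>k\<in>{N j..N (Suc j)}. \<bar>walk (A (Suc j)) (u @ v) k - y (\<tau> j)\<bar> > \<delta> (\<tau> j))) \<le> 47 / 48" for i j u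
    using s(2)[of j] by (auto simp: next_block_def A_def N_def case_prod_unfold)
  have N_mono: "strict_mono N" using N_less by (simp add: strict_mono_Suc_iff)
  have N_ge: "j \<le> N j" for j using N_mono by (rule strict_mono_imp_increasing)
  have A_agree: "A k i = A j i" if "j \<le> k" "i < N j" for i j k
    using that
  proof (induction k rule: dec_induct)
    case (step k)
    then have "i < N k" using strict_mono_less_eq[OF N_mono, of j k] by simp
    then show ?case using step A_Suc by simp
  qed simp
  define a where "a = (\<lambda>i. A (Suc i) i)"
  have a_A: "a i = A j i" if "i < N j" for i j
  proof -
    have "i < N (Suc i)" using N_ge[of "Suc i"] by simp
    then show ?thesis
      using A_agree[of "Suc i" j i] A_agree[of j "Suc i" i] that by (cases "j \<le> Suc i") (auto simp: a_def)
  qed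
  have a_mono: "strict_mono a"
    unfolding strict_mono_Suc_iff
  proof
    fix i
    have "Suc i < N (Suc (Suc i))" using N_ge[of "Suc (Suc i)"] by simp
    then show "a i < a (Suc i)"
      using strict_mono_onD[OF A_good(1)[of "Suc (Suc i)"], of i "Suc i"] by (simp add: a_A[of _ "Suc (Suc i)"])
  qed
  have a_ge: "0 \<le> a i \<and> f (Suc i) \<le> a i" for i
    using A_good(2)[of i "Suc i"] N_ge[of "Suc i"] by (simp add: a_def)
  define miss where "miss = (\<lambda>j w. \<forall>k\<in>{N j..N (Suc j)}. \<bar>walk a w k - y (\<tau> j)\<bar> > \<delta> (\<tau> j))"
  have miss_prob: "sign_mean (N (Suc j) - N j) (\<lambda>v. of_bool (miss j (u @ v))) \<le> 47 / 48"
    if "u \<in> signs (N j)" for u j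
  proof -
    have "walk a w k = walk (A (Suc j)) w k" if "k \<le> N (Suc j)" for w k
      using that a_A by (intro walk_cong) auto
    then show ?thesis using A_hits[OF that] by (simp add: miss_def)
  qed
  (* K collects the blocks that aim at one and the same target. *)
  have product: "sign_mean (N k) (\<lambda>w. of_bool (\<forall>j\<in>{..<k} \<inter> K. miss j w)) \<le> (47 / 48) ^ card ({..<k} \<inter> K)"
    for k K
  proof (induction k)
    case (Suc k)
    let ?G = "\<lambda>w. of_bool (\<forall>j\<in>{..<k} \<inter> K. miss j w) :: real"
    let ?q = "if k \<in> K then 47 / 48 else 1 :: real"
    have insert: "{..<Suc k} \<inter> K = (if k \<in> K then insert k ({..<k} \<inter> K) else {..<k} \<inter> K)"
      by (auto simp: less_Suc_eq)
    obtain r where r: "N (Suc k) = N k + r" using N_less[of k] less_imp_add_positive by metis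
    have prefix: "miss j (u @ v) \<longleftrightarrow> miss j u" if "j < k" "u \<in> signs (N k)" for j u v
    proof -
      have "N (Suc j) \<le> N k" using that strict_mono_less_eq[OF N_mono] by simp
      then show ?thesis
        using that by (auto simp: miss_def walk_append_left length_signs)
    qed
    have "sign_mean (N (Suc k)) (\<lambda>w. of_bool (\<forall>j\<in>{..<Suc k} \<inter> K. miss j w))
        = sign_mean (N k) (\<lambda>u. sign_mean r (\<lambda>v. ?G u * (if k \<in> K then of_bool (miss k (u @ v)) else 1)))"
      unfolding r sign_mean_append insert using prefix by (intro sign_mean_cong) auto
    also have "\<dots> \<le> sign_mean (N k) (\<lambda>u. ?G u * ?q)"
    proof (rule sign_mean_mono)
      fix u assume "u \<in> signs (N k)"
      then have "sign_mean r (\<lambda>v. if k \<in> K then of_bool (miss k (u @ v)) else 1) \<le> ?q"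
        using miss_prob[of u k] by (simp add: r)
      then show "sign_mean r (\<lambda>v. ?G u * (if k \<in> K then of_bool (miss k (u @ v)) else 1)) \<le> ?G u * ?q"
        unfolding sign_mean_cmult by (intro mult_left_mono) auto
    qed
    also have "\<dots> = ?q * sign_mean (N k) ?G"
      by (simp add: mult.commute[of _ ?q] sign_mean_cmult)
    also have "\<dots> \<le> ?q * (47 / 48) ^ card ({..<k} \<inter> K)"
      using Suc by (intro mult_left_mono) auto
    also have "\<dots> = (47 / 48) ^ card ({..<Suc k} \<inter> K)"
      by (simp add: insert)
    finally show ?case .
  qed simp
  have "\<exists>n. sign_mean n (\<lambda>w. of_bool (\<forall>k\<le>n. \<bar>walk a w k - y i\<bar> > \<delta> i)) < c" if "c > 0" for i c
  proof -
    obtain p where p: "(47 / 48 :: real) ^ p < c" using real_arch_pow_inv[OF \<open>c > 0\<close>, of "47 / 48"] by auto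
    define K where "K = {j. \<tau> j = i}"
    have "range (\<lambda>l. prod_encode (i, l)) \<subseteq> K" by (auto simp: K_def \<tau>_def)
    moreover have "infinite (range (\<lambda>l. prod_encode (i, l)))"
      by (intro range_inj_infinite injI) simp
    ultimately have "infinite K" using finite_subset by blast
    then obtain F where F: "finite F" "card F = p" "F \<subseteq> K" using infinite_arbitrarily_large by blast
    obtain k where "F \<subseteq> {..<k}" using finite_nat_iff_bounded F(1) by blast
    with F have card: "p \<le> card ({..<k} \<inter> K)" by (auto intro!: card_mono)
    have "sign_mean (N k) (\<lambda>w. of_bool (\<forall>l\<le>N k. \<bar>walk a w l - y i\<bar> > \<delta> i))
        \<le> sign_mean (N k) (\<lambda>w. of_bool (\<forall>j\<in>{..<k} \<inter> K. miss j w))"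
    proof (rule sign_mean_mono)
      fix w
      have "miss j w" if "\<forall>l\<le>N k. \<bar>walk a w l - y i\<bar> > \<delta> i" "j \<in> {..<k} \<inter> K" for j
      proof -
        have "N (Suc j) \<le> N k" using that strict_mono_less_eq[OF N_mono] by simp
        then show ?thesis using that by (auto simp: miss_def K_def)
      qed
      then show "of_bool (\<forall>l\<le>N k. \<bar>walk a w l - y i\<bar> > \<delta> i)
          \<le> (of_bool (\<forall>j\<in>{..<k} \<inter> K. miss j w) :: real)"
        by (simp only: of_bool_less_eq_iff) blast
    qed
    also have "\<dots> \<le> (47 / 48) ^ card ({..<k} \<inter> K)" by (rule product)
    also have "\<dots> \<le> (47 / 48) ^ p" using card by (intro power_decreasing) auto
    also note p
    finally show ?thesis by blast
  qed
  with a_mono a_ge show ?thesis by blast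
qed

section \<open>Transfer to a Rademacher sequence\<close>

context prob_space
begin

lemma rademacher_measurable:
  assumes "rademacher_sequence \<epsilon>" "k \<ge> 1"
  shows "\<epsilon> k \<in> borel_measurable M"
  using assms unfolding rademacher_sequence_def indep_vars_def by auto

lemma rademacher_prob:
  assumes "rademacher_sequence \<epsilon>" "k \<ge> 1" "s = -1 \<or> s = 1"
  shows "prob {\<omega> \<in> space M. \<epsilon> k \<omega> = s} = 1 / 2"
  using assms unfolding rademacher_sequence_def by blast

lemma rademacher_signs_AE:
  assumes "rademacher_sequence \<epsilon>"
  shows "AE \<omega> in M. \<forall>k\<ge>1. \<epsilon> k \<omega> \<in> {-1, 1}"
proof -
  have "AE \<omega> in M. \<epsilon> k \<omega> \<in> {-1, 1}" if k: "k \<ge> 1" for k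
  proof -
    note [measurable] = rademacher_measurable[OF assms k]
    have "prob {\<omega> \<in> space M. \<epsilon> k \<omega> = 1 \<or> \<epsilon> k \<omega> = -1}
        = prob ({\<omega> \<in> space M. \<epsilon> k \<omega> = 1} \<union> {\<omega> \<in> space M. \<epsilon> k \<omega> = -1})"
      by (intro arg_cong[where f = prob]) auto
    also have "\<dots> = prob {\<omega> \<in> space M. \<epsilon> k \<omega> = 1} + prob {\<omega> \<in> space M. \<epsilon> k \<omega> = -1}"
      by (intro finite_measure_Union) auto
    also have "\<dots> = 1" using rademacher_prob[OF assms k, of 1] rademacher_prob[OF assms k, of "-1"] by simp
    finally have "AE \<omega> in M. \<epsilon> k \<omega> = 1 \<or> \<epsilon> k \<omega> = -1"
      by (subst (asm) prob_Collect_eq_1) auto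
    then show ?thesis by eventually_elim auto
  qed
  then have "AE \<omega> in M. k \<ge> 1 \<longrightarrow> \<epsilon> k \<omega> \<in> {-1, 1}" for k by (cases "k \<ge> 1") auto
  then show ?thesis by (simp add: AE_all_countable)
qed

lemma rademacher_pattern_prob:
  assumes "rademacher_sequence \<epsilon>" "w \<in> signs n"
  shows "prob {\<omega> \<in> space M. \<forall>i<n. \<epsilon> (Suc i) \<omega> = w ! i} = (1 / 2) ^ n"
proof (cases "n = 0")
  case True
  then show ?thesis by (simp add: prob_space)
next
  case False
  have shift: "(\<forall>k\<in>{1..n}. P k) \<longleftrightarrow> (\<forall>i<n. P (Suc i))" for P
    by (metis One_nat_def Suc_le_eq Suc_le_mono atLeastAtMost_iff not0_implies_Suc not_less_eq_eq le0)
  have "{\<omega> \<in> space M. \<forall>i<n. \<epsilon> (Suc i) \<omega> = w ! i} = (\<Inter>k\<in>{1..n}. \<epsilon> k -` {w ! (k - 1)} \<inter> space M)"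
    using False shift[of "\<lambda>k. \<epsilon> k _ = w ! (k - 1)"] by auto
  also have "prob \<dots> = (\<Prod>k\<in>{1..n}. prob (\<epsilon> k -` {w ! (k - 1)} \<inter> space M))"
    using assms(1) False unfolding rademacher_sequence_def by (intro indep_varsD) auto
  also have "\<dots> = (\<Prod>k\<in>{1..n}. 1 / 2)"
  proof (intro prod.cong refl)
    fix k assume k: "k \<in> {1..n}"
    have eq: "\<epsilon> k -` {s} \<inter> space M = {\<omega> \<in> space M. \<epsilon> k \<omega> = s}" for s by auto
    show "prob (\<epsilon> k -` {w ! (k - 1)} \<inter> space M) = 1 / 2"
      unfolding eq using nth_signs[OF assms(2), of "k - 1"] k
      by (intro rademacher_prob[OF assms(1)]) auto
  qed
  finally show ?thesis by simp
qed

text \<open>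
  The event is stated through sign lists, since a Rademacher variable may take values other than
  \<open>1\<close> and \<open>-1\<close> on a null set.
\<close>

lemma rademacher_prefix_prob:
  assumes "rademacher_sequence \<epsilon>"
  shows "prob {\<omega> \<in> space M. \<exists>w\<in>signs n. Q w \<and> (\<forall>i<n. \<epsilon> (Suc i) \<omega> = w ! i)} \<le> sign_mean n (\<lambda>w. of_bool (Q w))"
proof -
  have [measurable]: "\<epsilon> (Suc i) \<in> borel_measurable M" for i
    by (intro rademacher_measurable[OF assms]) simp
  let ?E = "\<lambda>w. {\<omega> \<in> space M. \<forall>i<n. \<epsilon> (Suc i) \<omega> = w ! i}"
  have "{\<omega> \<in> space M. \<exists>w\<in>signs n. Q w \<and> (\<forall>i<n. \<epsilon> (Suc i) \<omega> = w ! i)} = (\<Union>w\<in>signs n \<inter> Collect Q. ?E w)"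
    by auto
  also have "prob \<dots> \<le> (\<Sum>w\<in>signs n \<inter> Collect Q. prob (?E w))"
    by (intro finite_measure_subadditive_finite) auto
  also have "\<dots> = (\<Sum>w\<in>signs n \<inter> Collect Q. (1 / 2) ^ n)"
    by (intro sum.cong rademacher_pattern_prob[OF assms]) auto
  also have "\<dots> = sign_mean n (\<lambda>w. of_bool (Q w))"
    by (simp add: sign_mean_def of_bool_def sum.If_cases power_divide)
  finally show ?thesis .
qed

lemma rademacher_walk_hits_AE:
  assumes rad: "rademacher_sequence \<epsilon>"
    and small: "\<And>c. c > 0 \<Longrightarrow> \<exists>n. sign_mean n (\<lambda>w. of_bool (\<forall>k\<le>n. \<bar>walk (\<lambda>i. a (Suc i)) w k - y\<bar> > \<delta>)) < c"
  shows "AE \<omega> in M. \<exists>n. \<bar>rademacher_walk \<epsilon> a n \<omega> - y\<bar> \<le> \<delta>"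
proof -
  have [measurable]: "rademacher_walk \<epsilon> a n \<in> borel_measurable M" for n
    unfolding rademacher_walk_def[abs_def]
    by (intro borel_measurable_sum borel_measurable_times borel_measurable_const
        rademacher_measurable[OF rad]) simp
  define Z where "Z = {\<omega> \<in> space M. (\<forall>n. \<bar>rademacher_walk \<epsilon> a n \<omega> - y\<bar> > \<delta>)}"
  have [measurable]: "Z \<in> sets M" unfolding Z_def by measurable
  have "prob Z < c" if "c > 0" for c
  proof -
    obtain n where n: "sign_mean n (\<lambda>w. of_bool (\<forall>k\<le>n. \<bar>walk (\<lambda>i. a (Suc i)) w k - y\<bar> > \<delta>)) < c"
      using small[OF \<open>c > 0\<close>] by blast
    let ?Q = "\<lambda>w. \<forall>k\<le>n. \<bar>walk (\<lambda>i. a (Suc i)) w k - y\<bar> > \<delta>"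
    let ?U = "{\<omega> \<in> space M. \<exists>w\<in>signs n. ?Q w \<and> (\<forall>i<n. \<epsilon> (Suc i) \<omega> = w ! i)}"
    have meas: "?U \<in> sets M"
    proof -
      have [measurable]: "\<epsilon> (Suc i) \<in> borel_measurable M" for i
        by (intro rademacher_measurable[OF rad]) simp
      have "?U = (\<Union>w\<in>signs n \<inter> Collect ?Q. {\<omega> \<in> space M. \<forall>i<n. \<epsilon> (Suc i) \<omega> = w ! i})" by auto
      also have "\<dots> \<in> sets M" by (intro sets.finite_UN) auto
      finally show ?thesis .
    qed
    have "AE \<omega> in M. \<omega> \<in> Z \<longrightarrow> \<omega> \<in> ?U"
      using rademacher_signs_AE[OF rad]
    proof eventually_elim
      case (elim \<omega>)
      show ?case
      proof
        assume Z: "\<omega> \<in> Z"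
        define w where "w = map (\<lambda>i. \<epsilon> (Suc i) \<omega>) [0..<n]"
        have "w \<in> signs n" using elim by (auto simp: w_def signs_def)
        moreover have "walk (\<lambda>i. a (Suc i)) w k = rademacher_walk \<epsilon> a k \<omega>" if "k \<le> n" for k
          using that unfolding walk_def rademacher_walk_def w_def
          by (simp add: sum.atLeast1_atMost_eq)
        ultimately show "\<omega> \<in> ?U" using Z by (auto simp: Z_def w_def intro!: bexI[of _ w])
      qed
    qed
    then have "prob Z \<le> prob ?U" by (rule finite_measure_mono_AE[OF _ meas])
    also have "\<dots> \<le> sign_mean n (\<lambda>w. of_bool (?Q w))" by (rule rademacher_prefix_prob[OF rad])
    finally show ?thesis using n by simp
  qed
  then have "prob Z = 0" by (metis less_irrefl measure_nonneg order_le_less)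
  then have "AE \<omega> in M. \<omega> \<notin> Z" by (intro AE_not_in) (simp add: null_sets_def emeasure_eq_measure)
  then show ?thesis
    using AE_space by eventually_elim (auto simp: Z_def not_less)
qed

end

theorem theorem4:
  fixes M :: "'a measure" and \<epsilon> :: "nat \<Rightarrow> 'a \<Rightarrow> real" and f :: "nat \<Rightarrow> real"
  assumes "prob_space M"
    and "prob_space.rademacher_sequence M \<epsilon>"
    and "mono_on {1..} f"
  shows "\<exists>a :: nat \<Rightarrow> real.
           strict_mono_on {1..} a \<and>
           (\<forall>n\<ge>1. 0 \<le> a n) \<and>
           (\<forall>n\<ge>1. f n \<le> a n) \<and>
           topologically_recurrent M (rademacher_walk \<epsilon> a)"
proof -
  interpret prob_space M by fact
  (* An enumeration of all pairs of a rational target and a precision 1 / (j + 1). *)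
  define y :: "nat \<Rightarrow> real" where "y = (\<lambda>i. of_rat (fst (from_nat i :: rat \<times> nat)))"
  define \<delta> :: "nat \<Rightarrow> real" where "\<delta> = (\<lambda>i. inverse (Suc (snd (from_nat i :: rat \<times> nat))))"
  have \<delta>_pos: "\<delta> i > 0" for i by (simp add: \<delta>_def)
  from hitting_steps[of f \<delta> y, OF assms(3) \<delta>_pos] obtain b where b: "strict_mono b"
      "\<And>i. 0 \<le> b i \<and> f (Suc i) \<le> b i"
    and hits: "\<And>i c. c > 0 \<Longrightarrow> \<exists>n. sign_mean n (\<lambda>w. of_bool (\<forall>k\<le>n. \<bar>walk b w k - y i\<bar> > \<delta> i)) < c"
    by blast
  define a where "a = (\<lambda>n. b (n - 1))"
  have b_a: "b = (\<lambda>i. a (Suc i))" by (simp add: a_def)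
  have "AE \<omega> in M. \<exists>n. \<bar>rademacher_walk \<epsilon> a n \<omega> - y i\<bar> \<le> \<delta> i" for i
    using assms(2) hits unfolding b_a by (intro rademacher_walk_hits_AE) auto
  then have "AE \<omega> in M. \<forall>i. \<exists>n. \<bar>rademacher_walk \<epsilon> a n \<omega> - y i\<bar> \<le> \<delta> i"
    by (simp add: AE_all_countable)
  then have "topologically_recurrent M (rademacher_walk \<epsilon> a)"
    unfolding topologically_recurrent_def
  proof eventually_elim
    case (elim \<omega>)
    show ?case
    proof (intro set_eqI iffI UNIV_I)
      fix x :: real
      show "x \<in> closure (range (\<lambda>n. rademacher_walk \<epsilon> a n \<omega>))"
        unfolding closure_approachable
      proof (intro allI impI)
        fix d :: real assume "d > 0"
        obtain j where j: "inverse (Suc j) < d / 2" using reals_Archimedean[of "d / 2"] \<open>d > 0\<close> by auto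
        obtain q where q: "x < of_rat q" "of_rat q < x + d / 2"
          using of_rat_dense[of x "x + d / 2"] \<open>d > 0\<close> by auto
        obtain n where "\<bar>rademacher_walk \<epsilon> a n \<omega> - y (to_nat (q, j))\<bar> \<le> \<delta> (to_nat (q, j))"
          using elim by blast
        then have "\<bar>rademacher_walk \<epsilon> a n \<omega> - of_rat q\<bar> \<le> inverse (Suc j)" by (simp add: y_def \<delta>_def)
        with j q have "dist (rademacher_walk \<epsilon> a n \<omega>) x < d" by (simp add: dist_real_def)
        then show "\<exists>z\<in>range (\<lambda>n. rademacher_walk \<epsilon> a n \<omega>). dist z x < d" by blast
      qed
    qed
  qed
  moreover have "strict_mono_on {1..} a"
    using b(1) by (intro strict_mono_onI) (auto simp: a_def strict_mono_less)
  moreover have "0 \<le> a n \<and> f n \<le> a n" if "n \<ge> 1" for n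
    using b(2)[of "n - 1"] that by (simp add: a_def)
  ultimately show ?thesis by blast
qed

end
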